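(* Let Assumptions (U), (L) and (D) of the context hold. Suppose that $l^*(\boldsymbol{x}) = l(\boldsymbol{x}, y^*(\boldsymbol{x}))$ is $\mu$-strongly convex on $\mathbb{X}$, and denote by $\boldsymbol{x}^*$ the unique minimizer of $l^*$ on $\mathbb{X}$. Write $\eta = 1 - 2\gamma r + r^2 L_y^2$ and $G_l = G_x + L_x G_y$, and assume the normalization $\mu = 1$ and $\gamma = 1$. Let $T \in \mathbb{N}$ (non-negative integers). (i) For any $(\bar{\boldsymbol{x}}, \bar{\boldsymbol{y}}) \in \mathbb{X}\times\mathbb{Y}$ that solves the $T$-step Cournot game, i.e. $\bar{\boldsymbol{x}} \in \arg\min_{\boldsymbol{x}\in\mathbb{X}} l^{(T)}(\boldsymbol{x}, \bar{\boldsymbol{y}})$ and $\bar{\boldsymbol{y}} \in \mathbb{Y}^*(\bar{\boldsymbol{x}})$, the quantity $\bar\delta^T = l^{(T)}(\bar{\boldsymbol{x}}, \bar{\boldsymbol{y}}) - l^*(\boldsymbol{x}^* )$ satisfies $$0 \le \bar\delta^T \le G_l \cdot G_y L_x \cdot \eta^{T/2}.$$ (ii) Assume further that $d_{\max} = \operatorname{diam}(\mathbb{Y}) < \infty$. For any $(\hat{\boldsymbol{x}}, \hat{\boldsymbol{y}})$ that solves the $T$-step monopoly model, i.e. $(\hat{\boldsymbol{x}}, \hat{\boldsymbol{y}}) \in \arg\min_{\boldsymbol{x}\in\mathbb{X},\, \boldsymbol{y}\in\mathbb{Y}} l^{(T)}(\boldsymbol{x}, \boldsymbol{y})$, the quantity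 $\hat\delta^T = l^*(\boldsymbol{x}^* ) - l^{(T)}(\hat{\boldsymbol{x}}, \hat{\boldsymbol{y}})$ satisfies $$0 \le \hat\delta^T \le M \cdot G_l \cdot \eta^{T/2} + G_y d_{\max}\cdot (1 + H_{xy} + L_x H_{yy})\cdot (T+1)\cdot \eta^{T/2},$$ where $M = 2 G_y L_x + G_{xy} d_{\max} + 2 L_x G_{yy} d_{\max} + G_y H_x$.
   Context: Setting. $\mathbb{X} \subseteq \mathbb{R}^m$ and $\mathbb{Y}\subseteq\mathbb{R}^n$ are sets, $l:\mathbb{X}\times\mathbb{Y}\to\mathbb{R}$ and $f:\mathbb{X}\times\mathbb{Y}\to\mathbb{R}^n$ are functions. For $\boldsymbol{x}\in\mathbb{X}$, $\mathbb{Y}^*(\boldsymbol{x}) = \{\boldsymbol{y}^*\in\mathbb{Y} : \langle f(\boldsymbol{x},\boldsymbol{y}^* ), \boldsymbol{y}-\boldsymbol{y}^*\rangle\ge 0 \ \ \forall \boldsymbol{y}\in\mathbb{Y}\}$. For a fixed step size $r>0$, $h:\mathbb{X}\times\mathbb{Y}\to\mathbb{Y}$ is the projection map $$h(\boldsymbol{x},\boldsymbol{y}) = \arg\min_{\boldsymbol{y}'\in\mathbb{Y}} \|\boldsymbol{y}' - (\boldsymbol{y} - r f(\boldsymbol{x},\boldsymbol{y}))\|_2^2 .$$ Set $h^{(0)}(\boldsymbol{x},\boldsymbol{y})=\boldsymbol{y}$, $h^{(t+1)}(\boldsymbol{x},\boldsymbol{y}) = h(\boldsymbol{x}, h^{(t)}(\boldsymbol{x},\boldsymbol{y}))$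 for $t\ge 0$, and $l^{(T)}(\boldsymbol{x},\boldsymbol{y}) = l(\boldsymbol{x}, h^{(T)}(\boldsymbol{x},\boldsymbol{y}))$. Assumption (U). $\mathbb{X}$ is closed and convex; $l$ is twice continuously differentiable; for all $\boldsymbol{x}\in\mathbb{X},\boldsymbol{y}\in\mathbb{Y}$: $\|\nabla_{\boldsymbol{x}} l\|_2\le G_x$, $\|\nabla_{\boldsymbol{y}} l\|_2\le G_y$, $\|\nabla_{\boldsymbol{x}\boldsymbol{y}} l\|_2\le G_{xy}$, $\|\nabla_{\boldsymbol{y}\boldsymbol{y}} l\|_2\le G_{yy}$ (at $(\boldsymbol{x},\boldsymbol{y})$). Assumption (L). $\mathbb{Y}$ is closed and convex; $f$ is continuously differentiable; there is $\gamma>0$ such that $f(\boldsymbol{x},\cdot)$ is $\gamma$-strongly monotone for all $\boldsymbol{x}\in\mathbb{X}$, i.e. $\langle f(\boldsymbol{x},\boldsymbol{y})-f(\boldsymbol{x},\boldsymbol{y}'),\boldsymbol{y}-\boldsymbol{y}'\rangle\ge\gamma\|\boldsymbol{y}-\boldsymbol{y}'\|_2^2$ for all $\boldsymbol{y},\boldsymbol{y}'\in\mathbb{Y}$; and $\|\nabla_{\boldsymbol{y}} f\|_2\le L_y$, $\|\nabla_{\boldsymbol{x}} f\|_2\le L_x$ on $\mathbb{X}\times\mathbb{Y}$. Assumption (D). $h$ is twice continuously differentiable; $r<2\gamma/L_y^2$; and $\|\nabla_{\boldsymbol{x}} h\|_2\le H_x$, $\|\nabla_{\boldsymbol{x}\boldsymbol{y}}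 h\|_2\le H_{xy}$, $\|\nabla_{\boldsymbol{y}\boldsymbol{y}} h\|_2\le H_{yy}$ on $\mathbb{X}\times\mathbb{Y}$. Under these assumptions $\mathbb{Y}^*(\boldsymbol{x})$ is a singleton for each $\boldsymbol{x}\in\mathbb{X}$; its element is written $y^*(\boldsymbol{x})$. $\|\cdot\|_2$ is the Euclidean norm and the induced operator norm; $\operatorname{diam}(\mathbb{Y}) = \max_{\boldsymbol{a},\boldsymbol{a}'\in\mathbb{Y}}\|\boldsymbol{a}-\boldsymbol{a}'\|_2$. A differentiable function $g$ is $\mu$-strongly convex on $\mathbb{X}$ if $g(\boldsymbol{x}')\ge g(\boldsymbol{x})+\langle\nabla g(\boldsymbol{x}),\boldsymbol{x}'-\boldsymbol{x}\rangle+\frac{\mu}{2}\|\boldsymbol{x}'-\boldsymbol{x}\|_2^2$ for all $\boldsymbol{x},\boldsymbol{x}'\in\mathbb{X}$. *)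

theory Defs
  imports "HOL-Analysis.Analysis"
begin

section \<open>Derivatives on the closed set \<open>X \<times> Y\<close>\<close>

text \<open>
  \<open>X\<close> and \<open>Y\<close> are only assumed closed and convex, so derivatives are taken within the set.
  If \<open>X \<times> Y\<close> has empty interior they need not be unique; the assumptions below then ask for
  \<^emph>\<open>some\<close> continuous choice obeying the bounds.  This covers the reading in which the functions
  are smooth on an open neighbourhood of \<open>X \<times> Y\<close>.
\<close>

definition has_C1_deriv ::
  "('a::real_normed_vector \<Rightarrow> 'b::real_normed_vector) \<Rightarrow> ('a \<Rightarrow> 'a \<Rightarrow>\<^sub>L 'b) \<Rightarrow> 'a set \<Rightarrow> bool" where
  "has_C1_deriv g g' S \<longleftrightarrow>
     (\<forall>z\<in>S. (g has_derivative blinfun_apply (g' z)) (at z within S)) \<and> continuous_on S g'"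

definition has_C2_deriv ::
  "('a::real_normed_vector \<Rightarrow> 'b::real_normed_vector) \<Rightarrow> ('a \<Rightarrow> 'a \<Rightarrow>\<^sub>L 'b) \<Rightarrow>
   ('a \<Rightarrow> 'a \<Rightarrow>\<^sub>L 'a \<Rightarrow>\<^sub>L 'b) \<Rightarrow> 'a set \<Rightarrow> bool" where
  "has_C2_deriv g g' g'' S \<longleftrightarrow> has_C1_deriv g g' S \<and> has_C1_deriv g' g'' S"

text \<open>
  Blocks of first and second total derivatives.  The norm on \<open>\<Rightarrow>\<^sub>L\<close> is the induced operator norm
  (and, for real-valued functions, the Euclidean norm of the gradient).
\<close>

definition Dx :: "(('a::real_normed_vector \<times> 'b::real_normed_vector) \<Rightarrow>\<^sub>L 'c::real_normed_vector) \<Rightarrow> 'a \<Rightarrow>\<^sub>L 'c"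
  where "Dx A = Blinfun (\<lambda>u. blinfun_apply A (u, 0))"

definition Dy :: "(('a::real_normed_vector \<times> 'b::real_normed_vector) \<Rightarrow>\<^sub>L 'c::real_normed_vector) \<Rightarrow> 'b \<Rightarrow>\<^sub>L 'c"
  where "Dy A = Blinfun (\<lambda>v. blinfun_apply A (0, v))"

definition Dxy ::
  "(('a::real_normed_vector \<times> 'b::real_normed_vector) \<Rightarrow>\<^sub>L ('a \<times> 'b) \<Rightarrow>\<^sub>L 'c::real_normed_vector) \<Rightarrow> 'a \<Rightarrow>\<^sub>L 'b \<Rightarrow>\<^sub>L 'c"
  where "Dxy B = Blinfun (\<lambda>u. Dy (blinfun_apply B (u, 0)))"

definition Dyy ::
  "(('a::real_normed_vector \<times> 'b::real_normed_vector) \<Rightarrow>\<^sub>L ('a \<times> 'b) \<Rightarrow>\<^sub>L 'c::real_normed_vector) \<Rightarrow> 'b \<Rightarrow>\<^sub>L 'b \<Rightarrow>\<^sub>L 'c"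
  where "Dyy B = Blinfun (\<lambda>v. Dy (blinfun_apply B (0, v)))"

lemma bounded_linear_inl: "bounded_linear (\<lambda>u. (u, 0))"
  by (intro bounded_linear_Pair bounded_linear_ident bounded_linear_zero)

lemma bounded_linear_inr: "bounded_linear (\<lambda>v. (0, v))"
  by (intro bounded_linear_Pair bounded_linear_ident bounded_linear_zero)

lemma Dx_apply [simp]: "blinfun_apply (Dx A) u = blinfun_apply A (u, 0)"
  unfolding Dx_def
  by (subst bounded_linear_Blinfun_apply)
     (auto intro: bounded_linear_compose[OF blinfun.bounded_linear_right bounded_linear_inl])

lemma Dy_apply [simp]: "blinfun_apply (Dy A) v = blinfun_apply A (0, v)"
  unfolding Dy_def
  by (subst bounded_linear_Blinfun_apply)
     (auto intro: bounded_linear_compose[OF blinfun.bounded_linear_right bounded_linear_inr])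

lemma bounded_linear_Dy: "bounded_linear Dy"
proof (rule bounded_linear_intro[where K = 1])
  fix A :: "('a \<times> 'b) \<Rightarrow>\<^sub>L 'c"
  show "norm (Dy A) \<le> norm A * 1"
  proof (rule norm_blinfun_bound)
    show "norm (blinfun_apply (Dy A) v) \<le> norm A * 1 * norm v" for v
      using norm_blinfun[of A "(0, v)"] by (simp add: norm_Pair)
  qed simp
qed (auto intro!: blinfun_eqI simp: blinfun.bilinear_simps)

lemma Dxy_apply [simp]:
  "blinfun_apply (blinfun_apply (Dxy B) u) v = blinfun_apply (blinfun_apply B (u, 0)) (0, v)"
proof -
  have "bounded_linear (\<lambda>u. Dy (blinfun_apply B (u, 0)))"
    by (intro bounded_linear_compose[OF bounded_linear_Dy]
        bounded_linear_compose[OF blinfun.bounded_linear_right bounded_linear_inl])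
  then show ?thesis
    by (simp add: Dxy_def bounded_linear_Blinfun_apply)
qed

lemma Dyy_apply [simp]:
  "blinfun_apply (blinfun_apply (Dyy B) v) w = blinfun_apply (blinfun_apply B (0, v)) (0, w)"
proof -
  have "bounded_linear (\<lambda>v. Dy (blinfun_apply B (0, v)))"
    by (intro bounded_linear_compose[OF bounded_linear_Dy]
        bounded_linear_compose[OF blinfun.bounded_linear_right bounded_linear_inr])
  then show ?thesis
    by (simp add: Dyy_def bounded_linear_Blinfun_apply)
qed


section \<open>Equilibria, projection map, and \<open>T\<close>-step loss\<close>

definition equilibria ::
  "'b set \<Rightarrow> ('a \<Rightarrow> 'b \<Rightarrow> 'b::euclidean_space) \<Rightarrow> 'a \<Rightarrow> 'b set" where
  "equilibria Y f x = {ys \<in> Y. \<forall>y\<in>Y. f x ys \<bullet> (y - ys) \<ge> 0}"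

definition y_star :: "'b set \<Rightarrow> ('a \<Rightarrow> 'b \<Rightarrow> 'b::euclidean_space) \<Rightarrow> 'a \<Rightarrow> 'b" where
  "y_star Y f x = (THE ys. ys \<in> equilibria Y f x)"

definition proj_map ::
  "'b set \<Rightarrow> real \<Rightarrow> ('a \<Rightarrow> 'b \<Rightarrow> 'b::euclidean_space) \<Rightarrow> 'a \<Rightarrow> 'b \<Rightarrow> 'b" where
  "proj_map Y r f x y = arg_min_on (\<lambda>y'. (norm (y' - (y - r *\<^sub>R f x y)))\<^sup>2) Y"

definition T_step_loss ::
  "('a \<Rightarrow> 'b \<Rightarrow> real) \<Rightarrow> ('a \<Rightarrow> 'b \<Rightarrow> 'b) \<Rightarrow> nat \<Rightarrow> 'a \<Rightarrow> 'b \<Rightarrow> real" where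
  "T_step_loss l h T x y = l x ((h x ^^ T) y)"

definition opt_loss ::
  "('a \<Rightarrow> 'b \<Rightarrow> real) \<Rightarrow> 'b set \<Rightarrow> ('a \<Rightarrow> 'b \<Rightarrow> 'b::euclidean_space) \<Rightarrow> 'a \<Rightarrow> real" where
  "opt_loss l Y f x = l x (y_star Y f x)"

definition the_minimizer :: "('a \<Rightarrow> real) \<Rightarrow> 'a set \<Rightarrow> 'a" where
  "the_minimizer g X = (THE x. is_arg_min g (\<lambda>x. x \<in> X) x)"

definition cournot_solution ::
  "'a set \<Rightarrow> 'b set \<Rightarrow> ('a \<Rightarrow> 'b \<Rightarrow> real) \<Rightarrow> ('a \<Rightarrow> 'b \<Rightarrow> 'b::euclidean_space) \<Rightarrow> real \<Rightarrow> nat \<Rightarrow>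
   'a \<Rightarrow> 'b \<Rightarrow> bool" where
  "cournot_solution X Y l f r T xb yb \<longleftrightarrow>
     is_arg_min (\<lambda>x. T_step_loss l (proj_map Y r f) T x yb) (\<lambda>x. x \<in> X) xb \<and>
     yb \<in> equilibria Y f xb"

definition monopoly_solution ::
  "'a set \<Rightarrow> 'b set \<Rightarrow> ('a \<Rightarrow> 'b \<Rightarrow> real) \<Rightarrow> ('a \<Rightarrow> 'b \<Rightarrow> 'b::euclidean_space) \<Rightarrow> real \<Rightarrow> nat \<Rightarrow>
   'a \<Rightarrow> 'b \<Rightarrow> bool" where
  "monopoly_solution X Y l f r T xh yh \<longleftrightarrow>
     is_arg_min (\<lambda>(x, y). T_step_loss l (proj_map Y r f) T x y) (\<lambda>p. p \<in> X \<times> Y) (xh, yh)"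


section \<open>Standing assumptions\<close>

definition assumption_U ::
  "'a::euclidean_space set \<Rightarrow> 'b::euclidean_space set \<Rightarrow> ('a \<Rightarrow> 'b \<Rightarrow> real) \<Rightarrow>
   real \<Rightarrow> real \<Rightarrow> real \<Rightarrow> real \<Rightarrow> bool" where
  "assumption_U X Y l G_x G_y G_xy G_yy \<longleftrightarrow>
     closed X \<and> convex X \<and>
     (\<exists>l' l''. has_C2_deriv (\<lambda>(x, y). l x y) l' l'' (X \<times> Y) \<and>
        (\<forall>z \<in> X \<times> Y. norm (Dx (l' z)) \<le> G_x \<and> norm (Dy (l' z)) \<le> G_y \<and>
           norm (Dxy (l'' z)) \<le> G_xy \<and> norm (Dyy (l'' z)) \<le> G_yy))"

definition assumption_L ::
  "'a::euclidean_space set \<Rightarrow> 'b::euclidean_space set \<Rightarrow> ('a \<Rightarrow> 'b \<Rightarrow> 'b) \<Rightarrow>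
   real \<Rightarrow> real \<Rightarrow> real \<Rightarrow> bool" where
  "assumption_L X Y f \<gamma> L_x L_y \<longleftrightarrow>
     closed Y \<and> convex Y \<and>
     0 < \<gamma> \<and>
     (\<forall>x\<in>X. \<forall>y\<in>Y. \<forall>y'\<in>Y. (f x y - f x y') \<bullet> (y - y') \<ge> \<gamma> * (norm (y - y'))\<^sup>2) \<and>
     (\<exists>f'. has_C1_deriv (\<lambda>(x, y). f x y) f' (X \<times> Y) \<and>
        (\<forall>z \<in> X \<times> Y. norm (Dy (f' z)) \<le> L_y \<and> norm (Dx (f' z)) \<le> L_x))"

text \<open>
  For \<open>L_y = 0\<close> the step-size bound \<open>2 * \<gamma> / L_y\<^sup>2\<close> is \<open>\<infinity>\<close>, not the value 0 of HOL division.
\<close>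

definition assumption_D ::
  "'a::euclidean_space set \<Rightarrow> 'b::euclidean_space set \<Rightarrow> ('a \<Rightarrow> 'b \<Rightarrow> 'b) \<Rightarrow>
   real \<Rightarrow> real \<Rightarrow> real \<Rightarrow> real \<Rightarrow> real \<Rightarrow> real \<Rightarrow> bool" where
  "assumption_D X Y f r \<gamma> L_y H_x H_xy H_yy \<longleftrightarrow>
     (L_y \<noteq> 0 \<longrightarrow> r < 2 * \<gamma> / L_y\<^sup>2) \<and>
     (\<exists>h' h''. has_C2_deriv (\<lambda>(x, y). proj_map Y r f x y) h' h'' (X \<times> Y) \<and>
        (\<forall>z \<in> X \<times> Y. norm (Dx (h' z)) \<le> H_x \<and>
           norm (Dxy (h'' z)) \<le> H_xy \<and> norm (Dyy (h'' z)) \<le> H_yy))"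

definition strongly_convex_diff_on ::
  "'a::euclidean_space set \<Rightarrow> ('a \<Rightarrow> real) \<Rightarrow> real \<Rightarrow> bool" where
  "strongly_convex_diff_on X g \<mu> \<longleftrightarrow>
     (\<exists>g'. (\<forall>x\<in>X. (g has_derivative (\<lambda>d. g' x \<bullet> d)) (at x within X)) \<and>
        (\<forall>x\<in>X. \<forall>x'\<in>X. g x' \<ge> g x + g' x \<bullet> (x' - x) + \<mu> / 2 * (norm (x' - x))\<^sup>2))"

text \<open>
  \<open>half_pow a T\<close> is \<open>a\<^bsup>T/2\<^esup>\<close> with \<open>a\<^bsup>0\<^esup> = 1\<close>, whereas \<open>0 powr 0 = 0\<close> in HOL; the case \<open>a = 0\<close>
  does arise, for instance with \<open>\<gamma> = r = L_y = 1\<close>.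
\<close>

definition half_pow :: "real \<Rightarrow> nat \<Rightarrow> real" where
  "half_pow a T = (if T = 0 then 1 else a powr (real T / 2))"

end

theory Submission
  imports Defs
begin

text \<open>
  The projection map is a contraction in \<open>y\<close> with factor \<open>\<kappa> = \<surd>\<eta>\<close> and fixed point \<open>y\<^sup>*(x)\<close>, and
  \<open>y\<^sup>*\<close> is \<open>L\<^sub>x/\<gamma>\<close>-Lipschitz by strong monotonicity.

  At a Cournot solution \<open>y = y\<^sup>*(x)\<close> is fixed by \<open>h(x, \<cdot>)\<close>, so \<open>l\<^sup>*\<close> and \<open>l\<^bsup>(T)\<^esup>(\<cdot>, y)\<close> agree at \<open>x\<close> and
  differ by at most \<open>c \<parallel>x' - x\<parallel>\<close> at \<open>x'\<close>, where \<open>c = G\<^sub>y L\<^sub>x \<kappa>\<^sup>T\<close>.  Hence \<open>x\<close> minimizes \<open>l\<^sup>*\<close> up to a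
  linear error of slope \<open>c\<close>; strong convexity gives \<open>\<parallel>x\<^sup>* - x\<parallel> \<le> c\<close>, and \<open>l\<^sup>*\<close> is \<open>G\<^sub>l\<close>-Lipschitz.

  At a monopoly solution already \<open>l\<^sup>*(x\<^sup>*) \<le> l\<^sup>*(x)\<close> and \<open>\<parallel>y\<^sup>*(x) - h\<^bsup>(T)\<^esup>(x, y)\<parallel> \<le> \<kappa>\<^sup>T d\<^sub>m\<^sub>a\<^sub>x\<close> bound the
  gap by \<open>G\<^sub>y d\<^sub>m\<^sub>a\<^sub>x \<kappa>\<^sup>T\<close>, which the claimed bound dominates.
\<close>

section \<open>Strong convexity\<close>

text \<open>The first-order inequality is applied at the intermediate point, once towards
  \<open>a\<close> and once towards \<open>b\<close>. Averaging with weights \<open>1 - t\<close>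
  and \<open>t\<close> cancels the gradient terms, and (1 - t) t^2 + t (1 - t)^2 = t (1 - t) gives
  the quadratic one.\<close>

lemma strongly_convex_diff_on_jensen:
  assumes sc: "strongly_convex_diff_on X g \<mu>" and X: "convex X"
    and ab: "a \<in> X" "b \<in> X" and t: "0 \<le> t" "t \<le> 1"
  shows "g (a + t *\<^sub>R (b - a)) \<le> (1 - t) * g a + t * g b - \<mu> / 2 * (t * (1 - t)) * (norm (b - a))\<^sup>2"
proof -
  define d where "d = b - a"
  define z where "z = a + t *\<^sub>R d"
  have z: "z \<in> X"
    using convexD_alt[OF X ab t] by (simp add: z_def d_def algebra_simps)
  obtain g' where g': "\<And>x x'. x \<in> X \<Longrightarrow> x' \<in> X \<Longrightarrow>
      g x' \<ge> g x + g' x \<bullet> (x' - x) + \<mu> / 2 * (norm (x' - x))\<^sup>2"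
    using sc unfolding strongly_convex_diff_on_def by blast
  have a: "a - z = (- t) *\<^sub>R d" and b: "b - z = (1 - t) *\<^sub>R d"
    by (simp_all add: z_def d_def algebra_simps)
  have "g a \<ge> g z - t * (g' z \<bullet> d) + \<mu> / 2 * (t\<^sup>2 * (norm d)\<^sup>2)"
    using g'[OF z ab(1)] unfolding a by (simp add: power_mult_distrib)
  from mult_left_mono[OF this, of "1 - t"]
  have 1: "(1 - t) * (g z - t * (g' z \<bullet> d) + \<mu> / 2 * (t\<^sup>2 * (norm d)\<^sup>2)) \<le> (1 - t) * g a"
    using t by simp
  have "g b \<ge> g z + (1 - t) * (g' z \<bullet> d) + \<mu> / 2 * ((1 - t)\<^sup>2 * (norm d)\<^sup>2)"
    using g'[OF z ab(2)] unfolding b by (simp add: power_mult_distrib)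
  from mult_left_mono[OF this t(1)]
  have 2: "t * (g z + (1 - t) * (g' z \<bullet> d) + \<mu> / 2 * ((1 - t)\<^sup>2 * (norm d)\<^sup>2)) \<le> t * g b" .
  have "(1 - t) * (g z - t * (g' z \<bullet> d) + \<mu> / 2 * (t\<^sup>2 * (norm d)\<^sup>2)) +
      t * (g z + (1 - t) * (g' z \<bullet> d) + \<mu> / 2 * ((1 - t)\<^sup>2 * (norm d)\<^sup>2)) =
      g z + \<mu> / 2 * (t * (1 - t)) * (norm d)\<^sup>2"
    by (simp add: field_simps power2_eq_square)
  with 1 2 show ?thesis
    unfolding d_def[symmetric] z_def[symmetric] by linarith
qed

text \<open>Near-minimality of \<open>a\<close> is compared with the Jensen bound on the segment
  towards \<open>b\<close>; dividing by \<open>t\<close> and letting \<open>t\<close> tend to 0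
  leaves the full coefficient \<open>\<mu> / 2\<close>. The slope \<open>c = 0\<close> covers exact
  minimizers.\<close>

lemma strongly_convex_diff_on_approx_min:
  assumes sc: "strongly_convex_diff_on X g \<mu>" and X: "convex X"
    and ab: "a \<in> X" "b \<in> X"
    and approx: "\<And>x. x \<in> X \<Longrightarrow> g a - c * norm (x - a) \<le> g x"
  shows "g a + \<mu> / 2 * (norm (b - a))\<^sup>2 \<le> g b + c * norm (b - a)"
proof -
  let ?d = "norm (b - a)"
  have "g a - g b - c * ?d \<le> - \<mu> / 2 * (1 - t) * ?d\<^sup>2" if t: "0 < t" "t < 1" for t
  proof -
    have "a + t *\<^sub>R (b - a) \<in> X"
      using convexD_alt[OF X ab, of t] t by (simp add: algebra_simps)
    from approx[OF this] have "g a - c * (t * ?d) \<le> g (a + t *\<^sub>R (b - a))"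
      using t by simp
    also have "\<dots> \<le> (1 - t) * g a + t * g b - \<mu> / 2 * (t * (1 - t)) * ?d\<^sup>2"
      using strongly_convex_diff_on_jensen[OF sc X ab, of t] t by simp
    finally have "t * (g a - g b - c * ?d) \<le> t * (- \<mu> / 2 * (1 - t) * ?d\<^sup>2)"
      by (simp add: algebra_simps)
    then show ?thesis
      using t(1) by (simp only: mult_le_cancel_left_pos)
  qed
  then have ev: "\<forall>\<^sub>F t in at_right 0. g a - g b - c * ?d \<le> - \<mu> / 2 * (1 - t) * ?d\<^sup>2"
    by (intro eventually_at_rightI[of 0 1]) auto
  have "((\<lambda>t. - \<mu> / 2 * (1 - t) * ?d\<^sup>2) \<longlongrightarrow> - \<mu> / 2 * (1 - 0) * ?d\<^sup>2) (at_right 0)"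
    by (intro tendsto_intros)
  from tendsto_lowerbound[OF this ev] show ?thesis
    by simp
qed

text \<open>As \<open>X\<close> may be unbounded, existence rests on coercivity, read off from the
  first-order inequality at one point. Uniqueness is quadratic growth around a minimizer.\<close>

lemma strongly_convex_diff_on_the_minimizer:
  fixes X :: "'a::euclidean_space set"
  assumes sc: "strongly_convex_diff_on X g \<mu>" and \<mu>: "0 < \<mu>"
    and X: "closed X" "convex X" "X \<noteq> {}"
  shows "the_minimizer g X \<in> X" and "x \<in> X \<Longrightarrow> g (the_minimizer g X) \<le> g x"
proof -
  obtain x0 where x0: "x0 \<in> X"
    using X(3) by blast
  obtain g' where der: "\<And>x. x \<in> X \<Longrightarrow> (g has_derivative (\<lambda>d. g' x \<bullet> d)) (at x within X)"
    and g': "\<And>x x'. x \<in> X \<Longrightarrow> x' \<in> X \<Longrightarrow>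
      g x' \<ge> g x + g' x \<bullet> (x' - x) + \<mu> / 2 * (norm (x' - x))\<^sup>2"
    using sc unfolding strongly_convex_diff_on_def by blast
  \<comment> \<open>Beyond this radius the quadratic term of the inequality at \<open>x0\<close>
    outweighs the linear one, so \<open>g x0 \<le> g x\<close> there and the minimum over the
    compact \<open>S\<close> is global.\<close>
  define S where "S = X \<inter> cball x0 (2 * norm (g' x0) / \<mu>)"
  have "continuous_on X g"
    using der has_derivative_continuous continuous_on_eq_continuous_within by blast
  moreover have "compact S"
    unfolding S_def using X(1) by (simp add: closed_Int_compact)
  moreover have x0S: "x0 \<in> S"
    using x0 \<mu> by (simp add: S_def)
  ultimately obtain m where m: "m \<in> S" "\<And>x. x \<in> S \<Longrightarrow> g m \<le> g x"
    using continuous_attains_inf[of S g] continuous_on_subset[of X g S] S_def by blast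
  have min: "g m \<le> g x" if x: "x \<in> X" for x
  proof (cases "x \<in> S")
    case False
    let ?n = "norm (x - x0)"
    have "2 * norm (g' x0) / \<mu> < ?n"
      using False x by (simp add: S_def dist_norm norm_minus_commute)
    then have "norm (g' x0) \<le> \<mu> / 2 * ?n"
      using \<mu> by (simp add: field_simps)
    then have "norm (g' x0) * ?n \<le> \<mu> / 2 * ?n * ?n"
      by (rule mult_right_mono) simp
    moreover have "- (norm (g' x0) * ?n) \<le> g' x0 \<bullet> (x - x0)"
      using Cauchy_Schwarz_ineq2[of "g' x0" "x - x0"] by linarith
    ultimately have "g x0 \<le> g x"
      using g'[OF x0 x] by (simp add: power2_eq_square)
    then show ?thesis
      using m(2)[OF x0S] by linarith
  qed (use m in simp)
  have mX: "m \<in> X"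
    using m(1) by (simp add: S_def)
  have "the_minimizer g X = m"
    unfolding the_minimizer_def
  proof (rule the_equality)
    show "is_arg_min g (\<lambda>x. x \<in> X) m"
      using mX min by (auto simp: is_arg_min_linorder)
    fix x assume "is_arg_min g (\<lambda>x. x \<in> X) x"
    then have x: "x \<in> X" "g x \<le> g m"
      using mX by (auto simp: is_arg_min_linorder)
    have "g m + \<mu> / 2 * (norm (x - m))\<^sup>2 \<le> g x + 0 * norm (x - m)"
      by (rule strongly_convex_diff_on_approx_min[OF sc X(2) mX x(1)]) (use min in simp)
    with x(2) have "\<mu> / 2 * (norm (x - m))\<^sup>2 \<le> 0"
      by linarith
    with \<mu> show "x = m"
      by (simp add: mult_le_0_iff)
  qed
  then show "the_minimizer g X \<in> X" and "x \<in> X \<Longrightarrow> g (the_minimizer g X) \<le> g x"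
    using mX min by simp_all
qed

section \<open>Lipschitz bounds from partial derivatives\<close>

text \<open>The mean value inequality on the convex slice with \<open>y\<close> frozen: a derivative
  within \<open>X \<times> Y\<close> restricts to the slice, where the chain rule turns it into the
  block \<open>Dx\<close>.\<close>

lemma has_C1_deriv_lipschitz_fst:
  assumes C1: "has_C1_deriv (\<lambda>(x, y). g x y) g' (X \<times> Y)" and X: "convex X"
    and B: "\<And>z. z \<in> X \<times> Y \<Longrightarrow> norm (Dx (g' z)) \<le> B"
    and "x \<in> X" "x' \<in> X" and y: "y \<in> Y"
  shows "norm (g x y - g x' y) \<le> B * norm (x - x')"
proof (rule differentiable_bound[OF X _ _ assms(4,5)])
  fix u assume u: "u \<in> X"
  have "((\<lambda>(x, y). g x y) has_derivative g' (u, y)) (at (u, y) within (\<lambda>u. (u, y)) ` X)"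
    using C1 u y unfolding has_C1_deriv_def by (blast intro: has_derivative_subset)
  moreover have "((\<lambda>u. (u, y)) has_derivative (\<lambda>v. (v, 0))) (at u within X)"
    by (auto intro!: derivative_eq_intros)
  ultimately have "((\<lambda>u. (case (u, y) of (x, y) \<Rightarrow> g x y)) has_derivative (\<lambda>v. g' (u, y) (v, 0)))
      (at u within X)"
    by (rule has_derivative_in_compose[rotated])
  moreover have "(\<lambda>v. g' (u, y) (v, 0)) = blinfun_apply (Dx (g' (u, y)))"
    by (simp add: fun_eq_iff)
  ultimately show "((\<lambda>x. g x y) has_derivative blinfun_apply (Dx (g' (u, y)))) (at u within X)"
    by simp
  show "onorm (Dx (g' (u, y))) \<le> B"
    using B[of "(u, y)"] u y by (simp add: norm_blinfun.rep_eq)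
qed

lemma has_C1_deriv_lipschitz_snd:
  assumes C1: "has_C1_deriv (\<lambda>(x, y). g x y) g' (X \<times> Y)" and Y: "convex Y"
    and B: "\<And>z. z \<in> X \<times> Y \<Longrightarrow> norm (Dy (g' z)) \<le> B"
    and "y \<in> Y" "y' \<in> Y" and x: "x \<in> X"
  shows "norm (g x y - g x y') \<le> B * norm (y - y')"
proof (rule differentiable_bound[OF Y _ _ assms(4,5)])
  fix u assume u: "u \<in> Y"
  have "((\<lambda>(x, y). g x y) has_derivative g' (x, u)) (at (x, u) within (\<lambda>u. (x, u)) ` Y)"
    using C1 u x unfolding has_C1_deriv_def by (blast intro: has_derivative_subset)
  moreover have "((\<lambda>u. (x, u)) has_derivative (\<lambda>v. (0, v))) (at u within Y)"
    by (auto intro!: derivative_eq_intros)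
  ultimately have "((\<lambda>u. (case (x, u) of (x, y) \<Rightarrow> g x y)) has_derivative (\<lambda>v. g' (x, u) (0, v)))
      (at u within Y)"
    by (rule has_derivative_in_compose[rotated])
  moreover have "(\<lambda>v. g' (x, u) (0, v)) = blinfun_apply (Dy (g' (x, u)))"
    by (simp add: fun_eq_iff)
  ultimately show "((\<lambda>y. g x y) has_derivative blinfun_apply (Dy (g' (x, u)))) (at u within Y)"
    by simp
  show "onorm (Dy (g' (x, u))) \<le> B"
    using B[of "(x, u)"] u x by (simp add: norm_blinfun.rep_eq)
qed

section \<open>The projection map\<close>

text \<open>Squaring preserves the order of norms, so both sides are Hilbert choices from equivalent
  predicates and agree even where no minimizer exists.\<close>

lemma proj_map_eq_closest_point: "proj_map Y r f x y = closest_point Y (y - r *\<^sub>R f x y)"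
  by (simp add: proj_map_def closest_point_def arg_min_on_def arg_min_def is_arg_min_linorder
      Ball_def dist_norm norm_minus_commute)

text \<open>A point of a closed convex set is a projection exactly when the displacement, here
  \<open>- r *\<^sub>R f x y\<close>, makes no acute angle with any direction into the set; the
  positive factor \<open>r\<close> drops out.\<close>

lemma proj_map_fixed_iff:
  assumes Y: "closed Y" "convex Y" and y: "y \<in> Y" and r: "0 < r"
  shows "proj_map Y r f x y = y \<longleftrightarrow> y \<in> equilibria Y f x"
proof
  assume fixed: "proj_map Y r f x y = y"
  have "0 \<le> f x y \<bullet> (z - y)" if "z \<in> Y" for z
    using closest_point_dot[OF Y(2,1) that, of "y - r *\<^sub>R f x y"] fixed r
    by (simp add: proj_map_eq_closest_point zero_le_mult_iff)
  with y show "y \<in> equilibria Y f x"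
    by (simp add: equilibria_def)
next
  assume "y \<in> equilibria Y f x"
  then have eq: "0 \<le> f x y \<bullet> (z - y)" if "z \<in> Y" for z
    using that by (simp add: equilibria_def)
  \<comment> \<open>The square of the right side exceeds that of the left by 2 r <f x y, z - y> + |z
    - y|^2.\<close>
  have "norm (r *\<^sub>R f x y) \<le> norm (r *\<^sub>R f x y + (z - y))" if "z \<in> Y" for z
    unfolding norm_le
    using mult_nonneg_nonneg[OF less_imp_le[OF r] eq[OF that]] inner_ge_zero[of "z - y"]
    unfolding inner_add_left inner_add_right inner_scaleR_left inner_scaleR_right
      inner_commute[of "z - y" "f x y"] distrib_left by linarith
  then have "\<forall>z\<in>Y. dist (y - r *\<^sub>R f x y) y \<le> dist (y - r *\<^sub>R f x y) z"
    by (simp add: dist_norm norm_minus_commute algebra_simps)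
  then show "proj_map Y r f x y = y"
    unfolding proj_map_eq_closest_point using closest_point_unique[OF Y(2,1) y] by simp
qed

text \<open>Smoothness enters only through Lipschitz constants. The factor \<open>\<kappa>\<close>
  is a parameter with \<open>\<kappa>\<^sup>2\<close> above \<eta> rather than the root of \<eta>,
  so that a negative \<eta> is covered as well.\<close>

locale projected_game =
  fixes X :: "'a::euclidean_space set" and Y :: "'b::euclidean_space set"
    and f :: "'a \<Rightarrow> 'b \<Rightarrow> 'b" and r \<gamma> Lx Ly \<kappa> :: real
  assumes Y: "closed Y" "convex Y" "Y \<noteq> {}"
    and r_pos: "0 < r" and \<gamma>_pos: "0 < \<gamma>" and Lx: "0 \<le> Lx"
    and monotone: "\<lbrakk>x \<in> X; y \<in> Y; y' \<in> Y\<rbrakk> \<Longrightarrow> \<gamma> * (norm (y - y'))\<^sup>2 \<le> (f x y - f x y') \<bullet> (y - y')"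
    and f_lipschitz_fst: "\<lbrakk>x \<in> X; x' \<in> X; y \<in> Y\<rbrakk> \<Longrightarrow> norm (f x y - f x' y) \<le> Lx * norm (x - x')"
    and f_lipschitz_snd: "\<lbrakk>x \<in> X; y \<in> Y; y' \<in> Y\<rbrakk> \<Longrightarrow> norm (f x y - f x y') \<le> Ly * norm (y - y')"
    and \<kappa>: "0 \<le> \<kappa>" "\<kappa> < 1" "1 - 2 * \<gamma> * r + r\<^sup>2 * Ly\<^sup>2 \<le> \<kappa>\<^sup>2"
begin

abbreviation "h \<equiv> proj_map Y r f"

lemma h_in: "h x y \<in> Y"
  using closest_point_in_set[OF Y(1,3)] by (simp add: proj_map_eq_closest_point)

lemma h_iter_in: "y \<in> Y \<Longrightarrow> (h x ^^ T) y \<in> Y"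
  by (cases T) (simp_all add: h_in)

text \<open>Projection is nonexpansive, so it suffices to bound the unprojected step. In its squared
  length strong monotonicity controls the cross term and the Lipschitz bound the last term, which
  produces exactly \<eta>.\<close>

lemma h_contraction:
  assumes x: "x \<in> X" and y: "y \<in> Y" "y' \<in> Y"
  shows "norm (h x y - h x y') \<le> \<kappa> * norm (y - y')"
proof -
  define d e where "d = y - y'" and "e = f x y - f x y'"
  have e: "(norm e)\<^sup>2 \<le> Ly\<^sup>2 * (norm d)\<^sup>2"
    using power_mono[OF f_lipschitz_snd[OF x y] norm_ge_zero, of 2]
    by (simp add: d_def e_def power_mult_distrib)
  have "norm (h x y - h x y') \<le> norm (d - r *\<^sub>R e)"
    using closest_point_lipschitz[OF Y(2,1,3), of "y - r *\<^sub>R f x y" "y' - r *\<^sub>R f x y'"]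
    by (simp add: proj_map_eq_closest_point dist_norm d_def e_def algebra_simps)
  also have "\<dots> \<le> \<kappa> * norm d"
  proof (rule power2_le_imp_le)
    have "(norm (d - r *\<^sub>R e))\<^sup>2 = (norm d)\<^sup>2 - 2 * r * (e \<bullet> d) + r\<^sup>2 * (norm e)\<^sup>2"
      unfolding power2_norm_eq_inner
      by (simp add: inner_diff_left inner_diff_right inner_commute[of d e] right_diff_distrib
          power2_eq_square)
    also have "\<dots> \<le> (norm d)\<^sup>2 - 2 * r * (\<gamma> * (norm d)\<^sup>2) + r\<^sup>2 * (Ly\<^sup>2 * (norm d)\<^sup>2)"
      using monotone[OF x y] e r_pos unfolding d_def[symmetric] e_def[symmetric]
      by (intro add_mono diff_mono mult_left_mono) auto
    also have "\<dots> = (1 - 2 * \<gamma> * r + r\<^sup>2 * Ly\<^sup>2) * (norm d)\<^sup>2"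
      by (simp add: algebra_simps)
    also have "\<dots> \<le> \<kappa>\<^sup>2 * (norm d)\<^sup>2"
      using \<kappa>(3) by (rule mult_right_mono) simp
    finally show "(norm (d - r *\<^sub>R e))\<^sup>2 \<le> (\<kappa> * norm d)\<^sup>2"
      by (simp add: power_mult_distrib)
  qed (use \<kappa> in simp)
  finally show ?thesis
    by (simp add: d_def)
qed

lemma h_iter_contraction:
  assumes "x \<in> X" "y \<in> Y" "y' \<in> Y"
  shows "norm ((h x ^^ T) y - (h x ^^ T) y') \<le> \<kappa> ^ T * norm (y - y')"
proof (induction T)
  case (Suc T)
  have "norm ((h x ^^ Suc T) y - (h x ^^ Suc T) y') \<le> \<kappa> * norm ((h x ^^ T) y - (h x ^^ T) y')"
    using h_contraction[OF assms(1) h_iter_in[OF assms(2)] h_iter_in[OF assms(3)]] by simp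
  also have "\<dots> \<le> \<kappa> * (\<kappa> ^ T * norm (y - y'))"
    using Suc \<kappa>(1) by (rule mult_left_mono)
  finally show ?case
    by simp
qed simp

text \<open>Each variational inequality is tested with the other solution and the two are added;
  strong monotonicity at \<open>x\<close> bounds the result below, the Lipschitz bound in the first
  argument bounds it above. The case \<open>x = x'\<close> yields uniqueness.\<close>

lemma equilibria_lipschitz:
  assumes x: "x \<in> X" "x' \<in> X" and y: "y \<in> equilibria Y f x" "y' \<in> equilibria Y f x'"
  shows "\<gamma> * norm (y - y') \<le> Lx * norm (x - x')"
proof (cases "y = y'")
  case True
  then show ?thesis
    using Lx by simp
next
  case False
  let ?n = "norm (y - y')"
  have Y: "y \<in> Y" "y' \<in> Y"
    using y by (simp_all add: equilibria_def)
  have "0 \<le> f x y \<bullet> (y' - y)" "0 \<le> f x' y' \<bullet> (y - y')"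
    using y Y by (simp_all add: equilibria_def)
  then have "(f x y - f x y') \<bullet> (y - y') \<le> (f x' y' - f x y') \<bullet> (y - y')"
    by (simp add: inner_diff_left inner_diff_right)
  also have "\<dots> \<le> norm (f x y' - f x' y') * ?n"
    using norm_cauchy_schwarz[of "f x' y' - f x y'" "y - y'"] by (simp add: norm_minus_commute)
  also have "\<dots> \<le> Lx * norm (x - x') * ?n"
    using f_lipschitz_fst[OF x Y(2)] by (rule mult_right_mono) simp
  finally have "\<gamma> * ?n * ?n \<le> Lx * norm (x - x') * ?n"
    using monotone[OF x(1) Y] by (simp add: power2_eq_square mult.assoc)
  then show ?thesis
    using False by (simp add: mult_le_cancel_right)
qed

lemma y_star_eqI:
  assumes x: "x \<in> X" and y: "y \<in> equilibria Y f x"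
  shows "y_star Y f x = y"
  unfolding y_star_def
proof (rule the_equality)
  show "y \<in> equilibria Y f x"
    by (rule y)
  fix z assume "z \<in> equilibria Y f x"
  from equilibria_lipschitz[OF x x this y] show "z = y"
    using \<gamma>_pos by (simp add: mult_le_0_iff)
qed

text \<open>Banach's theorem on the complete set \<open>Y\<close> gives a fixed point of
  \<open>h x\<close>, which is an equilibrium, and uniqueness identifies it with the definite
  description.\<close>

lemma y_star_equilibrium:
  assumes x: "x \<in> X"
  shows "y_star Y f x \<in> equilibria Y f x"
proof -
  have "\<exists>!y\<in>Y. h x y = y"
  proof (rule Banach_fix[OF _ Y(3) \<kappa>(1,2)])
    show "complete Y"
      using Y(1) by (simp add: complete_eq_closed)
    show "h x ` Y \<subseteq> Y"
      using h_in by blast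
    show "dist (h x y) (h x y') \<le> \<kappa> * dist y y'" if "y \<in> Y" "y' \<in> Y" for y y'
      using h_contraction[OF x that] by (simp add: dist_norm)
  qed
  then obtain y where "y \<in> Y" "h x y = y"
    by blast
  then have "y \<in> equilibria Y f x"
    using proj_map_fixed_iff[OF Y(1,2) _ r_pos] by metis
  with y_star_eqI[OF x this] show ?thesis
    by simp
qed

lemma y_star_in: "x \<in> X \<Longrightarrow> y_star Y f x \<in> Y"
  using y_star_equilibrium by (auto simp: equilibria_def)

lemma h_iter_y_star:
  assumes x: "x \<in> X"
  shows "(h x ^^ T) (y_star Y f x) = y_star Y f x"
proof -
  have "h x (y_star Y f x) = y_star Y f x"
    using proj_map_fixed_iff[OF Y(1,2) y_star_in[OF x] r_pos] y_star_equilibrium[OF x] by metis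
  then show ?thesis
    by (induction T) simp_all
qed

lemma dist_y_star_h_iter:
  assumes "x \<in> X" "y \<in> Y"
  shows "norm (y_star Y f x - (h x ^^ T) y) \<le> \<kappa> ^ T * norm (y_star Y f x - y)"
  using h_iter_contraction[OF assms(1) y_star_in[OF assms(1)] assms(2), of T]
  by (simp add: h_iter_y_star[OF assms(1)])

lemma y_star_lipschitz:
  assumes "x \<in> X" "x' \<in> X"
  shows "norm (y_star Y f x - y_star Y f x') \<le> Lx / \<gamma> * norm (x - x')"
  using equilibria_lipschitz[OF assms y_star_equilibrium[OF assms(1)] y_star_equilibrium[OF assms(2)]] \<gamma>_pos
  by (simp add: field_simps)

end

section \<open>Losses along the projected iteration: the Cournot and monopoly gaps\<close>

locale projected_game_loss = projected_game +
  fixes l :: "'a \<Rightarrow> 'b \<Rightarrow> real" and Gx Gy \<mu> :: real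
  assumes X: "closed X" "convex X" "X \<noteq> {}"
    and l_lipschitz_fst: "\<lbrakk>x \<in> X; x' \<in> X; y \<in> Y\<rbrakk> \<Longrightarrow> norm (l x y - l x' y) \<le> Gx * norm (x - x')"
    and l_lipschitz_snd: "\<lbrakk>x \<in> X; y \<in> Y; y' \<in> Y\<rbrakk> \<Longrightarrow> norm (l x y - l x y') \<le> Gy * norm (y - y')"
    and Gx: "0 \<le> Gx" and Gy: "0 \<le> Gy" and \<mu>_pos: "0 < \<mu>"
    and sc: "strongly_convex_diff_on X (opt_loss l Y f) \<mu>"
begin

abbreviation "l_opt \<equiv> opt_loss l Y f"
abbreviation "l_T \<equiv> T_step_loss l h"
abbreviation "x_star \<equiv> the_minimizer l_opt X"

lemmas x_star_in = strongly_convex_diff_on_the_minimizer(1)[OF sc \<mu>_pos X]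
lemmas x_star_min = strongly_convex_diff_on_the_minimizer(2)[OF sc \<mu>_pos X]

text \<open>The path goes through the pair (\<open>x\<close>, \<open>y_star Y f x'\<close>): first
  the equilibrium moves at fixed \<open>x\<close>, then \<open>x\<close> moves at a fixed
  equilibrium.\<close>

lemma l_opt_lipschitz:
  assumes x: "x \<in> X" "x' \<in> X"
  shows "\<bar>l_opt x - l_opt x'\<bar> \<le> (Gx + Lx / \<gamma> * Gy) * norm (x - x')"
proof -
  note y = y_star_in[OF x(1)] y_star_in[OF x(2)]
  have "\<bar>l x (y_star Y f x) - l x (y_star Y f x')\<bar> \<le> Gy * (Lx / \<gamma> * norm (x - x'))"
    using l_lipschitz_snd[OF x(1) y] mult_left_mono[OF y_star_lipschitz[OF x] Gy] by simp
  moreover have "\<bar>l x (y_star Y f x') - l x' (y_star Y f x')\<bar> \<le> Gx * norm (x - x')"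
    using l_lipschitz_fst[OF x y(2)] by simp
  ultimately show ?thesis
    unfolding opt_loss_def by (simp add: algebra_simps)
qed

lemma l_opt_eq_l_T: "x \<in> X \<Longrightarrow> l_opt x = l_T T x (y_star Y f x)"
  by (simp add: opt_loss_def T_step_loss_def h_iter_y_star)

lemma l_opt_diff_l_T:
  assumes x: "x \<in> X" and y: "y \<in> Y"
  shows "\<bar>l_opt x - l_T T x y\<bar> \<le> Gy * (\<kappa> ^ T * norm (y_star Y f x - y))"
proof -
  have "\<bar>l_opt x - l_T T x y\<bar> \<le> Gy * norm (y_star Y f x - (h x ^^ T) y)"
    using l_lipschitz_snd[OF x y_star_in[OF x] h_iter_in[OF y, of T x]]
    by (simp add: opt_loss_def T_step_loss_def)
  also have "\<dots> \<le> Gy * (\<kappa> ^ T * norm (y_star Y f x - y))"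
    using dist_y_star_h_iter[OF x y] Gy by (rule mult_left_mono)
  finally show ?thesis .
qed

lemma cournot_gap:
  assumes cs: "cournot_solution X Y l f r T xb yb"
  shows "0 \<le> l_T T xb yb - l_opt x_star"
    and "l_T T xb yb - l_opt x_star \<le>
      (Gx + Lx / \<gamma> * Gy) * (Gy * (Lx / \<gamma>) * \<kappa> ^ T / \<mu>)"
proof -
  have xb: "xb \<in> X" and min: "\<And>x. x \<in> X \<Longrightarrow> l_T T xb yb \<le> l_T T x yb"
    and eq: "yb \<in> equilibria Y f xb"
    using cs unfolding cournot_solution_def is_arg_min_linorder by auto
  note yb = y_star_eqI[OF xb eq, symmetric]
  have gap: "l_T T xb yb = l_opt xb"
    unfolding yb by (rule l_opt_eq_l_T[OF xb, symmetric])
  show "0 \<le> l_T T xb yb - l_opt x_star"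
    using x_star_min[OF xb] gap by simp
  define c d where "c = Gy * (Lx / \<gamma>) * \<kappa> ^ T" and "d = norm (x_star - xb)"
  \<comment> \<open>Since \<open>xb\<close> minimizes the loss with \<open>yb\<close> held fixed,
    \<open>l_opt xb = l_T T xb yb \<le> l_T T x yb\<close>, and the last loss is within
    \<open>c * norm (x - xb)\<close> of \<open>l_opt x\<close>.\<close>
  have approx: "l_opt xb - c * norm (x - xb) \<le> l_opt x" if x: "x \<in> X" for x
  proof -
    have "\<bar>l_opt x - l_T T x yb\<bar> \<le> Gy * (\<kappa> ^ T * norm (y_star Y f x - y_star Y f xb))"
      using l_opt_diff_l_T[OF x y_star_in[OF xb]] by (simp add: yb)
    also have "\<dots> \<le> Gy * (\<kappa> ^ T * (Lx / \<gamma> * norm (x - xb)))"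
      using y_star_lipschitz[OF x xb] Gy \<kappa>(1) by (intro mult_left_mono) auto
    also have "\<dots> = c * norm (x - xb)"
      by (simp add: c_def)
    finally show ?thesis
      using min[OF x] gap by linarith
  qed
  \<comment> \<open>Growth around \<open>xb\<close> and around \<open>x_star\<close> each contribute
    half of \<open>\<mu> * d\<^sup>2\<close>; the first alone would give a distance bound twice as
    large.\<close>
  have "l_opt xb + \<mu> / 2 * d\<^sup>2 \<le> l_opt x_star + c * d"
    unfolding d_def by (rule strongly_convex_diff_on_approx_min[OF sc X(2) xb x_star_in approx])
  moreover have "l_opt x_star + \<mu> / 2 * d\<^sup>2 \<le> l_opt xb + 0 * norm (xb - x_star)"
    unfolding d_def norm_minus_commute[of x_star xb]
    by (rule strongly_convex_diff_on_approx_min[OF sc X(2) x_star_in xb]) (use x_star_min in simp)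
  ultimately have "(\<mu> * d) * d \<le> c * d"
    by (simp add: power2_eq_square)
  moreover have c: "0 \<le> c"
    using Gy Lx \<gamma>_pos \<kappa>(1) by (simp add: c_def)
  ultimately have d: "d \<le> c / \<mu>"
    using \<mu>_pos by (cases "d = 0") (simp_all add: d_def field_simps)
  have "l_T T xb yb - l_opt x_star \<le> (Gx + Lx / \<gamma> * Gy) * d"
    using l_opt_lipschitz[OF xb x_star_in] gap by (simp add: d_def norm_minus_commute)
  also have "\<dots> \<le> (Gx + Lx / \<gamma> * Gy) * (c / \<mu>)"
    using d Gx Gy Lx \<gamma>_pos by (intro mult_left_mono) auto
  finally show "l_T T xb yb - l_opt x_star \<le>
      (Gx + Lx / \<gamma> * Gy) * (Gy * (Lx / \<gamma>) * \<kappa> ^ T / \<mu>)"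
    by (simp add: c_def)
qed

lemma monopoly_gap:
  assumes ms: "monopoly_solution X Y l f r T xh yh" and bd: "bounded Y"
  shows "0 \<le> l_opt x_star - l_T T xh yh"
    and "l_opt x_star - l_T T xh yh \<le> Gy * diameter Y * \<kappa> ^ T"
proof -
  have xh: "xh \<in> X" and yh: "yh \<in> Y"
    and min: "\<And>x y. x \<in> X \<Longrightarrow> y \<in> Y \<Longrightarrow> l_T T xh yh \<le> l_T T x y"
    using ms unfolding monopoly_solution_def is_arg_min_linorder by auto
  \<comment> \<open>The pair of \<open>x_star\<close> and its equilibrium is admissible, and its
    T-step loss is \<open>l_opt x_star\<close>.\<close>
  show "0 \<le> l_opt x_star - l_T T xh yh"
    using min[OF x_star_in y_star_in[OF x_star_in]] l_opt_eq_l_T[OF x_star_in, of T] by simp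
  \<comment> \<open>Passing from \<open>x_star\<close> to \<open>xh\<close> puts both losses at the
    same first argument, so only the second arguments remain to be compared.\<close>
  have "l_opt x_star - l_T T xh yh \<le> l_opt xh - l_T T xh yh"
    using x_star_min[OF xh] by simp
  also have "\<dots> \<le> Gy * (\<kappa> ^ T * norm (y_star Y f xh - yh))"
    using l_opt_diff_l_T[OF xh yh, of T] by linarith
  also have "\<dots> \<le> Gy * (\<kappa> ^ T * diameter Y)"
    using diameter_bounded_bound[OF bd y_star_in[OF xh] yh] Gy \<kappa>(1)
    by (intro mult_left_mono) (auto simp: dist_norm)
  finally show "l_opt x_star - l_T T xh yh \<le> Gy * diameter Y * \<kappa> ^ T"
    by (simp add: mult_ac)
qed

end

section \<open>Powers of \<eta>, and reduction of the assumptions to the abstract game\<close>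

lemma half_pow_nonneg: "0 \<le> half_pow a T"
  by (simp add: half_pow_def)

text \<open>Equality holds for positive \<open>a\<close> and for \<open>T = 0\<close>. Otherwise the
  left side is 0, while the right side is nonnegative whatever \<open>powr\<close> returns on a
  negative base.\<close>

lemma sqrt_max_power_le_half_pow: "sqrt (max a 0) ^ T \<le> half_pow a T"
proof (cases "T = 0 \<or> a \<le> 0")
  case False
  then have a: "0 < a" and T: "T \<noteq> 0"
    by auto
  have "sqrt a ^ T = (a powr (1 / 2)) powr real T"
    using a by (simp add: powr_realpow powr_half_sqrt)
  also have "\<dots> = a powr (real T / 2)"
    by (simp add: powr_powr)
  finally show ?thesis
    using a T by (simp add: half_pow_def)
qed (auto simp: half_pow_def max_def zero_power)

theorem theorem5p7:
  fixes X :: "(real ^ 'm) set" and Y :: "(real ^ 'n) set"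
    and l :: "real ^ 'm \<Rightarrow> real ^ 'n \<Rightarrow> real"
    and f :: "real ^ 'm \<Rightarrow> real ^ 'n \<Rightarrow> real ^ 'n"
    and r \<gamma> \<mu> G_x G_y G_xy G_yy L_x L_y H_x H_xy H_yy \<eta> G_l :: real
    and T :: nat
  assumes r_pos: "0 < r"
    and U: "assumption_U X Y l G_x G_y G_xy G_yy"
    and L: "assumption_L X Y f \<gamma> L_x L_y"
    and D: "assumption_D X Y f r \<gamma> L_y H_x H_xy H_yy"
    and sc: "strongly_convex_diff_on X (opt_loss l Y f) \<mu>"
    and mu: "\<mu> = 1" and gamma: "\<gamma> = 1"
    and eta: "\<eta> = 1 - 2 * \<gamma> * r + r\<^sup>2 * L_y\<^sup>2"
    and Gl: "G_l = G_x + L_x * G_y"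
  shows
    "(\<forall>xb\<in>X. \<forall>yb\<in>Y. cournot_solution X Y l f r T xb yb \<longrightarrow>
        (let \<delta> = T_step_loss l (proj_map Y r f) T xb yb
                  - opt_loss l Y f (the_minimizer (opt_loss l Y f) X)
         in 0 \<le> \<delta> \<and> \<delta> \<le> G_l * (G_y * L_x) * half_pow \<eta> T)) \<and>
     (bounded Y \<longrightarrow>
       (\<forall>xh yh. monopoly_solution X Y l f r T xh yh \<longrightarrow>
         (let d_max = diameter Y;
              M = 2 * G_y * L_x + G_xy * d_max + 2 * L_x * G_yy * d_max + G_y * H_x;
              \<delta> = opt_loss l Y f (the_minimizer (opt_loss l Y f) X)
                   - T_step_loss l (proj_map Y r f) T xh yh
          in 0 \<le> \<delta> \<and>
             \<delta> \<le> M * G_l * half_pow \<eta> T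
                  + G_y * d_max * (1 + H_xy + L_x * H_yy) * (real T + 1) * half_pow \<eta> T)))"
proof -
  \<comment> \<open>\<open>\<eta>\<close> can be negative when \<open>Y\<close> is a single point, since \<open>L_y < \<gamma>\<close> is then possible\<close>
  define \<kappa> where "\<kappa> = sqrt (max \<eta> 0)"
  have \<kappa>: "0 \<le> \<kappa>" "\<eta> \<le> \<kappa>\<^sup>2"
    by (simp_all add: \<kappa>_def)
  \<comment> \<open>Multiplying the step-size bound by \<open>r\<close> gives r^2 L_y^2 < 2 r; for
    \<open>L_y = 0\<close> positivity of \<open>r\<close> suffices.\<close>
  have "\<eta> < 1"
  proof (cases "L_y = 0")
    case False
    then have "r * L_y\<^sup>2 < 2"
      using D gamma by (simp add: assumption_D_def field_simps)
    then have "r * (r * L_y\<^sup>2) < r * 2"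
      using r_pos by (rule mult_strict_left_mono)
    then show ?thesis
      by (simp add: eta gamma power2_eq_square mult.assoc)
  qed (use r_pos in \<open>simp add: eta gamma\<close>)
  then have \<kappa>1: "\<kappa> < 1"
    by (simp add: \<kappa>_def)
  have \<kappa>T: "\<kappa> ^ T \<le> half_pow \<eta> T"
    unfolding \<kappa>_def by (rule sqrt_max_power_le_half_pow)
  obtain l' l'' where l2: "has_C2_deriv (\<lambda>(x, y). l x y) l' l'' (X \<times> Y)"
    and lbounds: "\<forall>z \<in> X \<times> Y. norm (Dx (l' z)) \<le> G_x \<and> norm (Dy (l' z)) \<le> G_y \<and>
      norm (Dxy (l'' z)) \<le> G_xy \<and> norm (Dyy (l'' z)) \<le> G_yy"
    using U unfolding assumption_U_def by blast
  have l: "has_C1_deriv (\<lambda>(x, y). l x y) l' (X \<times> Y)"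
    using l2 by (simp add: has_C2_deriv_def)
  have lb: "norm (Dx (l' z)) \<le> G_x" "norm (Dy (l' z)) \<le> G_y"
      "norm (Dxy (l'' z)) \<le> G_xy" "norm (Dyy (l'' z)) \<le> G_yy" if "z \<in> X \<times> Y" for z
    using bspec[OF lbounds that] by simp_all
  obtain f' where f: "has_C1_deriv (\<lambda>(x, y). f x y) f' (X \<times> Y)"
    and fbounds: "\<forall>z \<in> X \<times> Y. norm (Dy (f' z)) \<le> L_y \<and> norm (Dx (f' z)) \<le> L_x"
    using L unfolding assumption_L_def by blast
  have fb: "norm (Dx (f' z)) \<le> L_x" "norm (Dy (f' z)) \<le> L_y" if "z \<in> X \<times> Y" for z
    using bspec[OF fbounds that] by simp_all
  obtain h' h'' where "has_C2_deriv (\<lambda>(x, y). proj_map Y r f x y) h' h'' (X \<times> Y)"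
    and hbounds: "\<forall>z \<in> X \<times> Y. norm (Dx (h' z)) \<le> H_x \<and> norm (Dxy (h'' z)) \<le> H_xy \<and>
      norm (Dyy (h'' z)) \<le> H_yy"
    using D unfolding assumption_D_def by blast
  have hb: "norm (Dx (h' z)) \<le> H_x" "norm (Dxy (h'' z)) \<le> H_xy" "norm (Dyy (h'' z)) \<le> H_yy"
    if "z \<in> X \<times> Y" for z
    using bspec[OF hbounds that] by simp_all
  have X: "closed X" "convex X"
    using U by (simp_all add: assumption_U_def)
  have Y: "closed Y" "convex Y"
    using L by (simp_all add: assumption_L_def)
  \<comment> \<open>The constants are known to be nonnegative only as bounds of norms at some point;
    the solution pair under consideration supplies that point and also makes \<open>X\<close> and
    \<open>Y\<close> nonempty.\<close>
  have nonneg: "0 \<le> G_x" "0 \<le> G_y" "0 \<le> G_xy" "0 \<le> G_yy" "0 \<le> L_x" "0 \<le> H_x" "0 \<le> H_xy" "0 \<le> H_yy"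
    if "z \<in> X \<times> Y" for z
    using lb[OF that] fb[OF that] hb[OF that] by (auto intro: order_trans[OF norm_ge_zero])
  have game: "projected_game_loss X Y f r 1 L_x L_y \<kappa> l G_x G_y 1" if z: "z \<in> X \<times> Y" for z
  proof unfold_locales
    show "X \<noteq> {}" "Y \<noteq> {}"
      using z by auto
    show "1 * (norm (y - y'))\<^sup>2 \<le> (f x y - f x y') \<bullet> (y - y')"
      if "x \<in> X" "y \<in> Y" "y' \<in> Y" for x y y'
      using L that gamma unfolding assumption_L_def by blast
    show "1 - 2 * 1 * r + r\<^sup>2 * L_y\<^sup>2 \<le> \<kappa>\<^sup>2"
      using \<kappa>(2) by (simp add: eta gamma)
    show "strongly_convex_diff_on X (opt_loss l Y f) 1"
      using sc mu by simp
    show "norm (l x y - l x' y) \<le> G_x * norm (x - x')" if "x \<in> X" "x' \<in> X" "y \<in> Y" for x x' y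
      by (rule has_C1_deriv_lipschitz_fst[OF l X(2) lb(1) that])
    show "norm (l x y - l x y') \<le> G_y * norm (y - y')" if "x \<in> X" "y \<in> Y" "y' \<in> Y" for x y y'
      by (rule has_C1_deriv_lipschitz_snd[OF l Y(2) lb(2) that(2,3,1)])
    show "norm (f x y - f x' y) \<le> L_x * norm (x - x')" if "x \<in> X" "x' \<in> X" "y \<in> Y" for x x' y
      by (rule has_C1_deriv_lipschitz_fst[OF f X(2) fb(1) that])
    show "norm (f x y - f x y') \<le> L_y * norm (y - y')" if "x \<in> X" "y \<in> Y" "y' \<in> Y" for x y y'
      by (rule has_C1_deriv_lipschitz_snd[OF f Y(2) fb(2) that(2,3,1)])
  qed (use X Y r_pos nonneg[OF z] \<kappa> \<kappa>1 in simp_all)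
  show ?thesis
    unfolding Let_def
  \<comment> \<open>Instantiating \<open>conjI\<close> splits only the outer conjunction of the two
    claims and leaves each two-sided estimate whole.\<close>
  proof (intro conjI[of "\<forall>xb\<in>X. _ xb"] ballI allI impI)
    fix xb yb
    assume "xb \<in> X" "yb \<in> Y" and cs: "cournot_solution X Y l f r T xb yb"
    then have z: "(xb, yb) \<in> X \<times> Y"
      by simp
    interpret projected_game_loss X Y f r 1 L_x L_y \<kappa> l G_x G_y 1
      by (rule game[OF z])
    have "l_T T xb yb - l_opt x_star \<le> G_l * (G_y * L_x) * \<kappa> ^ T"
      using cournot_gap(2)[OF cs] by (simp add: Gl mult_ac)
    also have "\<dots> \<le> G_l * (G_y * L_x) * half_pow \<eta> T"
      using \<kappa>T nonneg[OF z] by (intro mult_left_mono) (auto simp: Gl)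
    finally show "0 \<le> l_T T xb yb - l_opt x_star \<and>
        l_T T xb yb - l_opt x_star \<le> G_l * (G_y * L_x) * half_pow \<eta> T"
      using cournot_gap(1)[OF cs] by simp
  next
    fix xh yh
    assume bd: "bounded Y" and ms: "monopoly_solution X Y l f r T xh yh"
    then have z: "(xh, yh) \<in> X \<times> Y"
      by (simp add: monopoly_solution_def is_arg_min_def)
    interpret projected_game_loss X Y f r 1 L_x L_y \<kappa> l G_x G_y 1
      by (rule game[OF z])
    note nonneg = nonneg[OF z] half_pow_nonneg[of \<eta> T] diameter_ge_0[OF bd]
    \<comment> \<open>wait\<close>
    let ?M = "2 * G_y * L_x + G_xy * diameter Y + 2 * L_x * G_yy * diameter Y + G_y * H_x"
    have "1 * 1 \<le> (1 + H_xy + L_x * H_yy) * (real T + 1)"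
      using nonneg by (intro mult_mono) auto
    then have factor: "1 \<le> (1 + H_xy + L_x * H_yy) * (real T + 1)"
      by simp
    have "l_opt x_star - l_T T xh yh \<le> G_y * diameter Y * \<kappa> ^ T"
      by (rule monopoly_gap(2)[OF ms bd])
    also have "\<dots> \<le> G_y * diameter Y * half_pow \<eta> T"
      using \<kappa>T nonneg by (intro mult_left_mono) auto
    also have "\<dots> \<le> G_y * diameter Y * half_pow \<eta> T * ((1 + H_xy + L_x * H_yy) * (real T + 1))"
      using mult_left_mono[OF factor, of "G_y * diameter Y * half_pow \<eta> T"] nonneg by simp
    also have "\<dots> = G_y * diameter Y * (1 + H_xy + L_x * H_yy) * (real T + 1) * half_pow \<eta> T"
      by (simp only: mult_ac)
    also have "\<dots> \<le> ?M * G_l * half_pow \<eta> T +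
        G_y * diameter Y * (1 + H_xy + L_x * H_yy) * (real T + 1) * half_pow \<eta> T"
      using nonneg by (simp add: Gl)
    finally show "0 \<le> l_opt x_star - l_T T xh yh \<and>
        l_opt x_star - l_T T xh yh \<le> ?M * G_l * half_pow \<eta> T +
          G_y * diameter Y * (1 + H_xy + L_x * H_yy) * (real T + 1) * half_pow \<eta> T"
      using monopoly_gap(1)[OF ms bd] by simp
  qed
qed

end
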